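(* Let $X_1,X_2,\dots$ be i.i.d. real-valued continuous random variables. Let $n\ge2$ and $\alpha\in\overline{\mathbb{H}}$. Assume that $$E\left[|X_1+\alpha|^{1-\eta}\right]=O\left(\eta^{-\ell}\right),\quad \eta\to+0,$$ for some $\ell>0$. Then $$\lim_{p\to+0}\frac{n^{1/p}M^{f^{(\alpha)}_p}_n-nM^{f^{(\alpha)}_1}_n}{n^{1/p}-n}=G^{(\alpha)}_n\quad\text{almost surely and in }L^1,$$ where, for $0<p<1$, $M^{f^{(\alpha)}_p}_n=\left(\frac1n\sum_{j=1}^n (X_j+\alpha)^p\right)^{1/p}-\alpha$, $M^{f^{(\alpha)}_1}_n=\frac1n\sum_{j=1}^n X_j$, and $G^{(\alpha)}_n=\prod_{j=1}^n (X_j+\alpha)^{1/n}-\alpha$.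
   Context: $\overline{\mathbb{H}}=\{z\in\mathbb{C}:\mathrm{Im}(z)\ge0\}$. Complex powers use the principal branch: $z^q=\exp(q\log z)$ with $\log z=\log r+i\theta$ for $z=r e^{i\theta}$, $r>0$, $\theta\in(-\pi,\pi]$; $0^p=0$ for $0<p<1$. Here $f^{(\alpha)}_p(x)=(x+\alpha)^p$ and $M^f_n=f^{-1}(\frac1n\sum_{j=1}^n f(X_j))$. $p\to+0$ means $p\to0$ with $p>0$. "Continuous" random variable means that its distribution function is continuous, i.e. $P(X_1=x)=0$ for every $x\in\mathbb{R}$. *)

theory Defs
  imports "HOL-Probability.Probability" "HOL-Library.Landau_Symbols"
begin

text \<open>The complex \<open>powr\<close> is the principal branch (arguments in \<open>(-pi, pi]\<close>), with
  \<open>0 powr q = 0\<close>.  Samples are indexed by \<open>1, \<dots>, n\<close>.\<close>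

text \<open>The quasi-arithmetic mean of \<open>x 1, \<dots>, x n\<close> generated by \<open>f x = (x + \<alpha>) powr p\<close>, whose
  inverse is \<open>w \<mapsto> w powr (1 / p) - \<alpha>\<close>; meant for \<open>0 < p < 1\<close>.\<close>

definition shifted_power_mean :: "complex \<Rightarrow> real \<Rightarrow> nat \<Rightarrow> (nat \<Rightarrow> real) \<Rightarrow> complex" where
  "shifted_power_mean \<alpha> p n x =
     ((1 / of_nat n) * (\<Sum>j=1..n. (complex_of_real (x j) + \<alpha>) powr complex_of_real p))
       powr complex_of_real (1 / p) - \<alpha>"

definition arithmetic_mean :: "nat \<Rightarrow> (nat \<Rightarrow> real) \<Rightarrow> real" where
  "arithmetic_mean n x = (1 / real n) * (\<Sum>j=1..n. x j)"

definition shifted_geometric_mean :: "complex \<Rightarrow> nat \<Rightarrow> (nat \<Rightarrow> real) \<Rightarrow> complex" where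
  "shifted_geometric_mean \<alpha> n x =
     (\<Prod>j=1..n. (complex_of_real (x j) + \<alpha>) powr (1 / of_nat n)) - \<alpha>"

definition mean_quotient :: "complex \<Rightarrow> real \<Rightarrow> nat \<Rightarrow> (nat \<Rightarrow> real) \<Rightarrow> complex" where
  "mean_quotient \<alpha> p n x =
     (complex_of_real (real n powr (1 / p)) * shifted_power_mean \<alpha> p n x
        - of_nat n * complex_of_real (arithmetic_mean n x))
     / complex_of_real (real n powr (1 / p) - real n)"

text \<open>Integrability is required explicitly because the Bochner integral of a non-integrable
  function is \<open>0\<close>.\<close>

definition tendsto_L1 ::
  "'a measure \<Rightarrow> ('i \<Rightarrow> 'a \<Rightarrow> complex) \<Rightarrow> ('a \<Rightarrow> complex) \<Rightarrow> 'i filter \<Rightarrow> bool" where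
  "tendsto_L1 M Y Z F \<longleftrightarrow>
     integrable M Z \<and> (\<forall>\<^sub>F p in F. integrable M (Y p)) \<and>
     ((\<lambda>p. \<integral>\<omega>. norm (Y p \<omega> - Z \<omega>) \<partial>M) \<longlongrightarrow> 0) F"

end

theory Submission
  imports Defs "HOL-Complex_Analysis.Cauchy_Integral_Theorem" "HOL-Real_Asymp.Real_Asymp"
begin

text \<open>Put \<open>z j = X j + \<alpha>\<close>, a point of the closed upper half-plane. The quotient equals \<open>Q p - \<alpha>\<close>, where
\<open>Q p = (N * A p - (\<Sum>j. z j)) / (N - n)\<close> with \<open>N = n powr (1 / p)\<close> and \<open>A p\<close> the power mean of order
\<open>p\<close> of the \<open>z j\<close> (\<open>mean_quotient_eq_centred_quotient\<close>).

Almost sure convergence: almost surely no \<open>z j\<close> vanishes, since the distribution has no atoms. Then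
\<open>A p\<close> is the exponential of a difference quotient at \<open>0\<close> of \<open>u \<mapsto> Ln ((1 / n) * (\<Sum>j. z j powr u))\<close>,
so \<open>A p\<close> tends to the geometric mean, and \<open>N\<close> tends to infinity (\<open>centred_quotient_tendsto_geometric_mean\<close>).

Convergence in mean: the first absolute moment may be infinite, so neither \<open>N * A p\<close> nor \<open>\<Sum>j. z j\<close>
need be integrable, and their large parts must cancel. Compare the two largest moduli \<open>a \<ge> b\<close> of the
\<open>z j\<close>. When \<open>a powr p\<close> and \<open>b powr p\<close> are within a factor two, \<open>Q p\<close> is bounded by a multiple of
\<open>a powr (3 / 4) * b powr (1 / 4)\<close>. Otherwise the largest sample cancels between the two terms, and what
remains is at most \<open>\<epsilon> p * (a powr (1 - p) * b powr p)\<close>, where \<open>\<epsilon> p = 5 / p * (3 / 4) powr (1 / p)\<close>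
decays exponentially in \<open>1 / p\<close> (\<open>centred_quotient_bound_two_largest\<close>).

Replace \<open>a\<close> and \<open>b\<close> by a sum over all pairs of distinct indices. By independence, each product has as
expectation a product of moments of orders below one. Hence the first bound is a fixed integrable
function, and the second has mean \<open>O (\<epsilon> p * p powr (- l))\<close>, which tends to \<open>0\<close>. Dominated convergence
holds up to such a vanishing term (\<open>L1_convergence_dominated_up_to_vanishing\<close>).\<close>

section \<open>The quotient without the translation\<close>

definition power_mean :: "real \<Rightarrow> nat \<Rightarrow> (nat \<Rightarrow> complex) \<Rightarrow> complex" where
  "power_mean p n z = ((1 / of_nat n) * (\<Sum>j=1..n. z j powr of_real p)) powr of_real (1 / p)"

text \<open>The quotient of the theorem with the translation by \<open>\<alpha>\<close> undone: the samples are the complex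
numbers \<open>z j = x j + \<alpha>\<close>, and the limit becomes their geometric mean. In this
form the estimates below involve the samples only through the moduli of the \<open>z j\<close>.\<close>

definition centred_quotient :: "real \<Rightarrow> nat \<Rightarrow> (nat \<Rightarrow> complex) \<Rightarrow> complex" where
  "centred_quotient p n z =
     (of_real (real n powr (1 / p)) * power_mean p n z - (\<Sum>j=1..n. z j))
     / of_real (real n powr (1 / p) - real n)"

lemma powr_gt_base:
  assumes "n \<ge> 2" "0 < p" "p < 1"
  shows "real n < real n powr (1 / p)"
proof -
  have "real n powr 1 < real n powr (1 / p)"
    using assms by (intro powr_less_mono) auto
  then show ?thesis using assms by simp
qed

text \<open>In the numerator \<open>\<alpha>\<close> occurs with the factor \<open>- n powr (1 / p)\<close> from the power mean and with
\<open>+ n\<close> from the arithmetic mean, so what it contributes to the quotient is exactly \<open>- \<alpha>\<close>.\<close>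

lemma mean_quotient_eq_centred_quotient:
  assumes "n \<ge> 2" "0 < p" "p < 1"
  shows "mean_quotient \<alpha> p n x = centred_quotient p n (\<lambda>j. of_real (x j) + \<alpha>) - \<alpha>"
proof -
  define N where "N = (of_real (real n powr (1 / p)) :: complex)"
  have "real n powr (1 / p) - real n \<noteq> 0"
    using powr_gt_base[OF assms] by simp
  then have nz: "N - of_nat n \<noteq> 0"
    unfolding N_def by (metis of_real_diff of_real_eq_0_iff of_real_of_nat_eq)
  have n0: "of_nat n \<noteq> (0::complex)" using assms by simp
  have "mean_quotient \<alpha> p n x =
      (N * (power_mean p n (\<lambda>j. of_real (x j) + \<alpha>) - \<alpha>) - (\<Sum>j=1..n. of_real (x j)))
        / (N - of_nat n)"
    using n0 unfolding mean_quotient_def shifted_power_mean_def power_mean_def arithmetic_mean_def N_def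
    by simp
  also have "\<dots> = (N * power_mean p n (\<lambda>j. of_real (x j) + \<alpha>) - (\<Sum>j=1..n. of_real (x j) + \<alpha>))
        / (N - of_nat n) - \<alpha>"
    using nz by (simp add: sum.distrib divide_simps) (simp add: algebra_simps)
  finally show ?thesis
    unfolding centred_quotient_def N_def by simp
qed

section \<open>Powers in the upper half-plane and the first quadrant\<close>

lemma cmod_powr_of_real: "cmod (z powr of_real r) = cmod z powr r"
  by (subst norm_powr_real_powr') auto

text \<open>Multiplying an argument in \<open>[0, pi]\<close> by \<open>p \<le> 1\<close> does not leave the range of the principal
branch, so no winding is lost between the two powers.\<close>

lemma powr_inverse_cancel_upper_half_plane:
  assumes "Im z \<ge> 0" "0 < p" "p \<le> 1"
  shows "(z powr of_real p) powr of_real (1 / p) = z"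
proof (cases "z = 0")
  case False
  have "0 \<le> Im (Ln z)" "Im (Ln z) \<le> pi"
    using Im_Ln_pos_le[OF False] assms by auto
  moreover from this have "p * Im (Ln z) \<le> 1 * pi"
    using assms by (intro mult_mono) auto
  moreover have "0 \<le> p * Im (Ln z)" using calculation assms by simp
  ultimately have "Ln (exp (of_real p * Ln z)) = of_real p * Ln z"
    using pi_gt_zero by (intro Ln_exp) (auto simp del: pi_gt_zero)
  then show ?thesis using False assms by (simp add: powr_def)
qed simp

lemma powr_first_quadrant:
  assumes "Im z \<ge> 0" "0 < p" "p \<le> 1 / 2"
  shows "Re (z powr of_real p) \<ge> 0" "Im (z powr of_real p) \<ge> 0"
proof -
  have "Re (z powr of_real p) \<ge> 0 \<and> Im (z powr of_real p) \<ge> 0"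
  proof (cases "z = 0")
    case False
    have "0 \<le> Im (Ln z)" "Im (Ln z) \<le> pi"
      using Im_Ln_pos_le[OF False] assms by auto
    moreover from this have "p * Im (Ln z) \<le> 1 / 2 * pi"
      using assms by (intro mult_mono) auto
    moreover have "0 \<le> p * Im (Ln z)" using calculation assms by simp
    ultimately show ?thesis using False pi_gt_zero
      by (auto simp: powr_def Re_exp Im_exp simp del: pi_gt_zero intro!: mult_nonneg_nonneg cos_ge_zero sin_ge_zero)
  qed simp
  then show "Re (z powr of_real p) \<ge> 0" "Im (z powr of_real p) \<ge> 0" by auto
qed

text \<open>This is the mean value inequality for \<open>u \<mapsto> u powr q\<close> on the segment from \<open>w\<close> to \<open>w + r\<close>. As
both numbers lie in the closed first quadrant and \<open>w\<close> is nonzero, the segment avoids the branch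
cut and the origin.\<close>

lemma powr_increment_bound:
  assumes w: "Re w \<ge> 0" "Im w \<ge> 0" "w \<noteq> 0" and r: "Re r \<ge> 0" "Im r \<ge> 0" and q: "q \<ge> 1"
  shows "cmod ((w + r) powr of_real q - w powr of_real q)
         \<le> q * (cmod w + cmod r) powr (q - 1) * cmod r"
proof -
  define S where "S = {u. u \<in> closed_segment w (w + r)}"
  have S: "u \<noteq> 0 \<and> Re u \<ge> 0 \<and> cmod u \<le> cmod w + cmod r" if "u \<in> S" for u
  proof -
    from that obtain t where t: "0 \<le> t" "t \<le> 1" and u: "u = w + of_real t * r"
      by (auto simp: S_def closed_segment_def scaleR_conv_of_real algebra_simps)
    have "cmod u \<le> cmod w + t * cmod r"
      unfolding u using t by (intro order.trans[OF norm_triangle_ineq]) (simp add: norm_mult)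
    moreover have "t * cmod r \<le> 1 * cmod r" using t by (intro mult_right_mono) auto
    moreover have "Re u = Re w + t * Re r" "Im u = Im w + t * Im r" by (auto simp: u)
    moreover have "t * Re r \<ge> 0" "t * Im r \<ge> 0" using t r by auto
    ultimately show ?thesis using w
      by (auto simp: complex_eq_iff)
  qed
  have "cmod ((w + r) powr of_real q - w powr of_real q)
      \<le> q * (cmod w + cmod r) powr (q - 1) * cmod (w + r - w)"
  proof (rule field_differentiable_bound[where S = S and f' = "\<lambda>u. of_real q * u powr of_real (q - 1)"])
    show "convex S" by (simp add: S_def)
    fix u assume u: "u \<in> S"
    have "u \<notin> \<real>\<^sub>\<le>\<^sub>0" using S[OF u] by (auto simp: complex_nonpos_Reals_iff complex_eq_iff)
    then show "((\<lambda>u. u powr of_real q) has_field_derivative of_real q * u powr of_real (q - 1)) (at u within S)"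
      using has_field_derivative_powr[of u "of_real q"]
      by (auto intro: has_field_derivative_at_within)
    show "cmod (of_real q * u powr of_real (q - 1)) \<le> q * (cmod w + cmod r) powr (q - 1)"
      using S[OF u] q by (auto simp: norm_mult cmod_powr_of_real simp del: of_real_diff
         intro!: mult_left_mono powr_mono2)
  qed (auto simp: S_def)
  then show ?thesis by simp
qed

section \<open>Pointwise convergence\<close>

text \<open>The logarithm of the average of the \<open>z j powr u\<close> vanishes at \<open>u = 0\<close> and has there the derivative
\<open>(1 / n) * (\<Sum>j. Ln (z j))\<close>. The power mean is the exponential of its difference
quotient at \<open>0\<close>.\<close>

lemma power_mean_tendsto_geometric_mean:
  assumes n: "n \<ge> 2" and z: "\<And>j. j \<in> {1..n} \<Longrightarrow> z j \<noteq> 0"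
  shows "((\<lambda>p. power_mean p n z) \<longlongrightarrow> (\<Prod>j=1..n. z j powr (1 / of_nat n))) (at_right 0)"
proof -
  define g where "g u = 1 / of_nat n * (\<Sum>j=1..n. exp (u * Ln (z j)))" for u :: complex
  define m where "m = 1 / of_nat n * (\<Sum>j=1..n. Ln (z j))"
  have g0: "g 0 = 1" using n by (simp add: g_def)
  have dg: "(g has_field_derivative m) (at 0)"
    unfolding g_def[abs_def] m_def using n by (auto intro!: derivative_eq_intros)
  have "((\<lambda>u. Ln (g u)) has_field_derivative inverse (g 0) * m) (at 0)"
    by (rule DERIV_chain2[OF _ dg]) (use has_field_derivative_Ln[of 1] in \<open>simp add: g0\<close>)
  then have "((\<lambda>u. (Ln (g (0 + u)) - Ln (g 0)) / u) \<longlongrightarrow> m) (at 0)"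
    by (intro DERIV_D) (simp add: g0)
  then have L: "((\<lambda>u. Ln (g u) / u) \<longlongrightarrow> m) (at 0)" by (simp add: g0)
  have c: "filterlim complex_of_real (at 0) (at_right 0)"
    by (auto simp: filterlim_at intro!: tendsto_eq_intros eventually_mono[OF eventually_at_right_less])
  have "((\<lambda>p. exp (Ln (g (of_real p)) / of_real p)) \<longlongrightarrow> exp m) (at_right 0)"
    by (intro tendsto_intros filterlim_compose[OF L c])
  moreover have "\<forall>\<^sub>F p in at_right 0. exp (Ln (g (of_real p)) / of_real p) = power_mean p n z"
  proof -
    have "(g \<longlongrightarrow> 1) (at 0)"
      using DERIV_isCont[OF dg] g0 by (simp add: isCont_def)
    then have "\<forall>\<^sub>F u in at 0. g u \<noteq> 0" by (rule tendsto_imp_eventually_ne) simp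
    then have "\<forall>\<^sub>F p in at_right 0. g (of_real p) \<noteq> 0"
      using c by (auto simp: filterlim_iff)
    then show ?thesis
    proof eventually_elim
      case (elim p)
      have "(\<Sum>j=1..n. z j powr of_real p) = (\<Sum>j=1..n. exp (of_real p * Ln (z j)))"
        using z by (intro sum.cong) (auto simp: powr_def)
      then have "power_mean p n z = g (of_real p) powr of_real (1 / p)"
        unfolding power_mean_def g_def by simp
      then show ?case using elim by (simp add: powr_def)
    qed
  qed
  moreover have "exp m = (\<Prod>j=1..n. z j powr (1 / of_nat n))"
    using z unfolding m_def sum_distrib_left by (subst exp_sum) (auto simp: powr_def intro!: prod.cong)
  ultimately show ?thesis using Lim_transform_eventually by fastforce
qed

text \<open>Since \<open>n powr (1 / p)\<close> tends to infinity, only the power mean survives in the quotient.\<close>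

lemma centred_quotient_tendsto_geometric_mean:
  assumes n: "n \<ge> 2" and z: "\<And>j. j \<in> {1..n} \<Longrightarrow> z j \<noteq> 0"
  shows "((\<lambda>p. centred_quotient p n z) \<longlongrightarrow> (\<Prod>j=1..n. z j powr (1 / of_nat n))) (at_right 0)"
proof -
  define N where "N p = real n powr (1 / p)" for p
  define r where "r = real n"
  have r: "r > 1" using n by (simp add: r_def)
  have ratio_1: "((\<lambda>p. N p / (N p - r)) \<longlongrightarrow> 1) (at_right 0)"
    and ratio_0: "((\<lambda>p. 1 / (N p - r)) \<longlongrightarrow> 0) (at_right 0)"
    unfolding N_def r_def[symmetric] using r by real_asymp+
  have "((\<lambda>p. of_real (N p / (N p - r)) * power_mean p n z - of_real (1 / (N p - r)) * (\<Sum>j=1..n. z j))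
          \<longlongrightarrow> of_real 1 * (\<Prod>j=1..n. z j powr (1 / of_nat n)) - of_real 0 * (\<Sum>j=1..n. z j)) (at_right 0)"
    by (intro tendsto_intros tendsto_of_real ratio_1 ratio_0
        power_mean_tendsto_geometric_mean assms)
  then show ?thesis
    by (simp add: centred_quotient_def N_def r_def diff_divide_distrib)
qed

section \<open>Pointwise bound by products over pairs\<close>

text \<open>In terms of \<open>s = t powr (1 / 4)\<close> the claim is \<open>(1 - s) * (s ^ 3 + s ^ 2 + s - 1) \<ge> 0\<close>, and the
second factor is nonnegative from \<open>s = 6 / 10\<close> on. By concavity of \<open>t powr \<theta>\<close> the same bound
holds for each positive \<open>\<theta>\<close> with \<open>2 powr (- \<theta>) \<ge> 3 / 4\<close>; a quarter is a convenient choice. The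
inequality bounds an average of a large and a smaller number by a weighted geometric mean in
which the smaller number occurs with a fixed positive exponent.\<close>

lemma midpoint_le_quarter_power:
  fixes t :: real
  assumes "1 / 2 \<le> t" "t \<le> 1"
  shows "(1 + t) / 2 \<le> t powr (1 / 4)"
proof -
  define s where "s = t powr (1 / 4)"
  have s4: "s ^ 4 = t" unfolding s_def using assms by (simp add: powr_power)
  have s0: "s \<ge> 0" "s \<le> 1" unfolding s_def using assms by (auto intro: powr_le1)
  have s6: "s \<ge> 6 / 10"
  proof (rule ccontr)
    assume "\<not> ?thesis"
    then have "s ^ 4 \<le> (6 / 10) ^ 4" using s0 by (intro power_mono) auto
    then show False using s4 assms by (simp add: field_simps)
  qed
  have "s ^ 2 \<ge> (6 / 10) ^ 2" "s ^ 3 \<ge> (6 / 10) ^ 3" using s6 by (auto intro: power_mono)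
  then have "s ^ 3 + s ^ 2 + s - 1 \<ge> 0" using s6 by (simp add: field_simps)
  then have "(1 - s) * (s ^ 3 + s ^ 2 + s - 1) \<ge> 0" using s0 by simp
  then have "(1 + s ^ 4) / 2 \<le> s" by (simp add: algebra_simps power3_eq_cube power4_eq_xxxx power2_eq_square)
  then show ?thesis by (simp add: s4) (simp add: s_def)
qed

lemma centred_quotient_le_numerator:
  assumes n: "n \<ge> 2" and p: "0 < p" "p \<le> 1 / 2"
  shows "cmod (centred_quotient p n z)
    \<le> 2 / real n powr (1 / p) * cmod (of_real (real n powr (1 / p)) * power_mean p n z - (\<Sum>j=1..n. z j))"
proof -
  define N where "N = real n powr (1 / p)"
  have "1 / p \<ge> 2" using p by (simp add: field_simps)
  then have "real n powr 2 \<le> N" unfolding N_def using n by (intro powr_mono) auto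
  moreover have "2 * real n \<le> real n powr 2"
    using n mult_right_mono[of 2 "real n" "real n"] by (simp add: power2_eq_square)
  ultimately have N: "2 * real n \<le> N" by (rule order.trans[rotated])
  have "cmod (centred_quotient p n z) = cmod (of_real N * power_mean p n z - (\<Sum>j=1..n. z j)) / \<bar>N - real n\<bar>"
    unfolding centred_quotient_def N_def[symmetric] norm_divide by (simp only: norm_of_real)
  also have "\<bar>N - real n\<bar> = N - real n" using N by simp
  also have "cmod (of_real N * power_mean p n z - (\<Sum>j=1..n. z j)) / (N - real n)
      \<le> cmod (of_real N * power_mean p n z - (\<Sum>j=1..n. z j)) / (N / 2)"
    using N n by (intro divide_left_mono mult_pos_pos) auto
  finally show ?thesis by (simp add: N_def mult.commute)
qed

text \<open>The core estimate. Let \<open>a \<ge> b\<close> be the two largest moduli, and put \<open>x = a powr p\<close>, \<open>y = b powr p\<close>,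
\<open>q = 1 / p\<close>, \<open>N = n powr q\<close>.

If \<open>y \<ge> x / 2\<close>, then no cancellation is needed: the average of the \<open>z j powr p\<close> is at
most \<open>(x + y) / 2\<close>, hence at most \<open>x powr (3 / 4) * y powr (1 / 4)\<close>, and raising this to the power
\<open>q\<close> bounds the power mean by \<open>a powr (3 / 4) * b powr (1 / 4)\<close>. The sum of the \<open>z j\<close> obeys the
same bound after division by \<open>N\<close>, because \<open>a\<close> exceeds \<open>b\<close> at most by the factor \<open>2 powr q\<close>.

If \<open>y < x / 2\<close>, then the largest sample \<open>z i\<close> occurs in \<open>N\<close> times the power mean and in the sum of
the \<open>z j\<close>, and it must be cancelled before taking moduli. With \<open>w = z i powr p\<close> and \<open>R\<close> the sum of
the other powers, what is left is \<open>(w + R) powr q - w powr q\<close>. By the mean value inequality this is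
of order \<open>q * (3 / 4 * n * x) powr (q - 1) * n * y\<close>, that is, of order
\<open>q * (3 / 4) powr q * N * (a powr (1 - p) * b powr p)\<close>. The exponentially small factor
\<open>(3 / 4) powr q\<close> is due to \<open>x + (n - 1) * y \<le> 3 / 4 * n * x\<close>.\<close>

lemma centred_quotient_bound_two_largest:
  assumes n: "n \<ge> 2" and p: "0 < p" "p \<le> 1 / 2"
    and z: "\<And>j. j \<in> {1..n} \<Longrightarrow> Im (z j) \<ge> 0"
    and ik: "i \<in> {1..n}" "k \<in> {1..n}" "i \<noteq> k"
    and i_max: "cmod (z k) \<le> cmod (z i)"
    and k_max: "\<And>j. j \<in> {1..n} \<Longrightarrow> j \<noteq> i \<Longrightarrow> cmod (z j) \<le> cmod (z k)"
  shows "cmod (centred_quotient p n z)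
     \<le> 4 * (cmod (z i) powr (3 / 4) * cmod (z k) powr (1 / 4))
       + 5 / p * (3 / 4) powr (1 / p) * (cmod (z i) powr (1 - p) * cmod (z k) powr p)"
proof (cases "z i = 0")
  case True
  have "z j = 0" if "j \<in> {1..n}" for j
    using True i_max k_max[OF that] by (cases "j = i") auto
  then have "centred_quotient p n z = 0"
    unfolding centred_quotient_def power_mean_def by simp
  then show ?thesis using p by simp
next
  case False
  define q where "q = 1 / p"
  define N where "N = real n powr q"
  define a where "a j = cmod (z j)" for j
  define x where "x j = a j powr p" for j
  define w where "w j = z j powr of_real p" for j
  define R where "R = (\<Sum>j\<in>{1..n} - {i}. w j)"
  define t where "t = x k / x i"
  have q: "q \<ge> 2" "p * q = 1" using p by (auto simp: q_def field_simps)
  have N0: "N > 0" using n by (simp add: N_def)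
  have a0: "a i > 0" "a j \<ge> 0" for j using False by (auto simp: a_def)
  have x0: "x i > 0" "x j \<ge> 0" for j using a0 by (auto simp: x_def)
  have xq: "x j powr q = a j" for j using a0 q by (simp add: x_def powr_powr)
  have w: "cmod (w j) = x j" for j by (simp add: w_def x_def a_def cmod_powr_of_real)
  have xk_le: "x k \<le> x i" unfolding x_def a_def using i_max p by (intro powr_mono2) auto
  have ak_le: "a k \<le> a i" using i_max by (simp add: a_def)
  have S_split: "(\<Sum>j=1..n. w j) = w i + R"
    unfolding R_def using ik by (simp add: sum.remove[of _ i])
  have z_split: "(\<Sum>j=1..n. z j) = z i + (\<Sum>j\<in>{1..n} - {i}. z j)"
    using ik by (simp add: sum.remove[of _ i])
  have R_le: "cmod R \<le> (real n - 1) * x k"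
  proof -
    have "cmod R \<le> (\<Sum>j\<in>{1..n} - {i}. x k)"
      unfolding R_def
    proof (rule sum_norm_le)
      fix j assume "j \<in> {1..n} - {i}"
      then show "cmod (w j) \<le> x k"
        unfolding w x_def a_def using k_max[of j] p by (intro powr_mono2) auto
    qed
    also have "\<dots> = (real n - 1) * x k" using ik n by (simp add: card_Diff_singleton of_nat_diff)
    finally show ?thesis .
  qed
  have rest_le: "cmod (\<Sum>j\<in>{1..n} - {i}. z j) \<le> (real n - 1) * a k"
  proof -
    have "cmod (\<Sum>j\<in>{1..n} - {i}. z j) \<le> (\<Sum>j\<in>{1..n} - {i}. a k)"
      by (rule sum_norm_le) (use k_max in \<open>auto simp: a_def\<close>)
    also have "\<dots> = (real n - 1) * a k" using ik n by (simp add: card_Diff_singleton of_nat_diff)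
    finally show ?thesis .
  qed
  define D where "D = a i powr (3 / 4) * a k powr (1 / 4)"
  define E where "E = a i powr (1 - p) * a k powr p"
  have D0: "D \<ge> 0" "E \<ge> 0" by (auto simp: D_def E_def)
  have num: "cmod (centred_quotient p n z) \<le> 2 / N * cmod (of_real N * power_mean p n z - (\<Sum>j=1..n. z j))"
    using centred_quotient_le_numerator[OF n p] by (simp add: N_def q_def)
  have mean: "power_mean p n z = (1 / of_nat n * (w i + R)) powr of_real q"
    unfolding power_mean_def q_def w_def[symmetric] S_split ..
  have "cmod (centred_quotient p n z) \<le> 4 * D + 5 * q * (3 / 4) powr q * E"
  proof (cases "t \<ge> 1 / 2")
    case True
    have t: "t \<le> 1" "x k = t * x i" using x0 xk_le by (auto simp: t_def field_simps)
    have "cmod (1 / of_nat n * (w i + R)) \<le> 1 / real n * (x i + (real n - 1) * x k)"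
      unfolding norm_mult using R_le w[of i] norm_triangle_ineq[of "w i" R]
      by (intro mult_mono) (auto simp: norm_divide)
    also have "\<dots> \<le> 1 / real n * (real n * ((x i + x k) / 2))"
    proof (intro mult_left_mono)
      have "0 \<le> (real n - 2) * (x i - x k)" using n xk_le by (intro mult_nonneg_nonneg) auto
      then show "x i + (real n - 1) * x k \<le> real n * ((x i + x k) / 2)" by (simp add: algebra_simps)
    qed simp
    also have "\<dots> = x i * ((1 + t) / 2)" using n t by (simp add: algebra_simps)
    also have "\<dots> \<le> x i * t powr (1 / 4)"
      using midpoint_le_quarter_power[OF True t(1)] x0 by (intro mult_left_mono) auto
    finally have "cmod (power_mean p n z) \<le> (x i * t powr (1 / 4)) powr q"
      unfolding mean cmod_powr_of_real using q by (intro powr_mono2) auto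
    also have "x i * t powr (1 / 4) = x i powr (3 / 4) * x k powr (1 / 4)"
    proof -
      have "x i powr (3 / 4) * x i powr (1 / 4) = x i" using x0 by (simp flip: powr_add)
      then have "x i * t powr (1 / 4) = x i powr (3 / 4) * (t powr (1 / 4) * x i powr (1 / 4))"
        by (simp add: mult_ac)
      also have "t powr (1 / 4) * x i powr (1 / 4) = x k powr (1 / 4)"
        unfolding t(2) using x0 True by (simp add: powr_mult)
      finally show ?thesis .
    qed
    also have "(x i powr (3 / 4) * x k powr (1 / 4)) powr q = D"
      using q unfolding D_def xq[symmetric] by (simp add: powr_mult powr_powr mult.commute)
    finally have A: "cmod (power_mean p n z) \<le> D" .
    have ai: "a i \<le> 2 powr (q / 4) * D"
    proof -
      have "a i powr (1 / 4) = x i powr (q / 4)" by (simp add: powr_powr flip: xq)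
      also have "\<dots> \<le> (2 * x k) powr (q / 4)"
        using True x0 q by (intro powr_mono2) (auto simp: t_def field_simps)
      also have "\<dots> = 2 powr (q / 4) * a k powr (1 / 4)"
        using x0 by (simp add: powr_mult powr_powr flip: xq)
      finally have "a i powr (3 / 4) * a i powr (1 / 4) \<le> a i powr (3 / 4) * (2 powr (q / 4) * a k powr (1 / 4))"
        by (intro mult_left_mono) auto
      moreover have "a i powr (3 / 4) * a i powr (1 / 4) = a i" using a0 by (simp flip: powr_add)
      ultimately show ?thesis by (simp add: D_def mult_ac)
    qed
    have "cmod (\<Sum>j=1..n. z j) \<le> a i + (real n - 1) * a k"
      unfolding z_split using rest_le norm_triangle_ineq[of "z i" "\<Sum>j\<in>{1..n} - {i}. z j"] by (simp add: a_def)
    also have "\<dots> \<le> real n * a i"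
      using mult_left_mono[OF ak_le, of "real n - 1"] n by (simp add: algebra_simps)
    also have "\<dots> \<le> real n * (real n powr (q / 4) * D)"
    proof (intro mult_left_mono order.trans[OF ai] mult_right_mono)
      show "2 powr (q / 4) \<le> real n powr (q / 4)" using n q by (intro powr_mono2) auto
    qed (use D0 in auto)
    also have "\<dots> = real n powr (1 + q / 4) * D" using n by (simp add: powr_add)
    also have "\<dots> \<le> N * D" unfolding N_def using n q D0
      by (intro mult_right_mono powr_mono) auto
    finally have B: "cmod (\<Sum>j=1..n. z j) \<le> N * D" .
    have "cmod (of_real N * power_mean p n z - (\<Sum>j=1..n. z j)) \<le> N * D + N * D"
      using A B N0 by (intro order.trans[OF norm_triangle_ineq4] add_mono) (auto simp: norm_mult intro!: mult_left_mono)
    then have "cmod (centred_quotient p n z) \<le> 2 / N * (N * D + N * D)"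
      using N0 by (intro order.trans[OF num] mult_left_mono) auto
    also have "\<dots> = 4 * D" using N0 by (simp add: field_simps)
    finally show ?thesis using D0 q by (simp add: add_increasing2)
  next
    case False
    then have xk_lt: "x k \<le> x i / 2" using x0 by (simp add: t_def field_simps)
    have "x i + (real n - 1) * x k \<le> x i + (real n - 1) * (x i / 2)"
      using xk_lt n by (intro add_left_mono mult_left_mono) auto
    also have "\<dots> \<le> 3 / 4 * real n * x i"
    proof -
      have "3 / 4 * real n * x i - (x i + (real n - 1) * (x i / 2)) = (real n - 2) * x i / 4"
        by (simp add: left_diff_distrib diff_divide_distrib)
      also have "\<dots> \<ge> 0" using n x0 by simp
      finally show ?thesis by simp
    qed
    finally have base: "cmod (w i) + cmod R \<le> 3 / 4 * real n * x i"
      using R_le w[of i] by simp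
    have "of_real N * power_mean p n z = of_nat n powr of_real q * (1 / of_nat n * (w i + R)) powr of_real q"
      unfolding mean N_def by (subst powr_of_real[symmetric]) auto
    also have "\<dots> = (of_nat n * (1 / of_nat n * (w i + R))) powr of_real q"
      by (intro powr_times_real_left[symmetric]) auto
    also have "\<dots> = (w i + R) powr of_real q" using n by simp
    finally have NA: "of_real N * power_mean p n z = (w i + R) powr of_real q" .
    have wi: "w i powr of_real q = z i"
      unfolding w_def q_def using z ik p by (intro powr_inverse_cancel_upper_half_plane) auto
    have quad: "Re (w j) \<ge> 0" "Im (w j) \<ge> 0" if "j \<in> {1..n}" for j
      unfolding w_def using powr_first_quadrant[OF z[OF that] p] by auto
    have "cmod ((w i + R) powr of_real q - z i) \<le> q * (cmod (w i) + cmod R) powr (q - 1) * cmod R"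
      unfolding wi[symmetric]
    proof (rule powr_increment_bound)
      show "w i \<noteq> 0" using w[of i] x0 by auto
      show "Re R \<ge> 0" "Im R \<ge> 0" using quad by (auto simp: R_def intro!: sum_nonneg)
    qed (use quad ik q in auto)
    also have "\<dots> \<le> q * (3 / 4 * real n * x i) powr (q - 1) * (real n * x k)"
    proof (intro mult_mono powr_mono2)
      show "cmod R \<le> real n * x k"
        using R_le x0(2)[of k] by (simp add: algebra_simps)
    qed (use q base x0 in auto)
    also have "\<dots> = q * (4 / 3 * (3 / 4) powr q) * N * E"
    proof -
      have "(3 / 4 * real n * x i) powr (q - 1)
          = (3 / 4) powr (q - 1) * real n powr (q - 1) * x i powr (q - 1)"
        using x0 powr_mult[of "3 / 4 * real n" "x i" "q - 1"] powr_mult[of "3 / 4" "real n" "q - 1"]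
        by simp
      then have "q * (3 / 4 * real n * x i) powr (q - 1) * (real n * x k)
          = q * (3 / 4) powr (q - 1) * (real n powr (q - 1) * real n) * (x i powr (q - 1) * x k)"
        by (simp only: mult_ac)
      also have "(3 / 4 :: real) powr (q - 1) = 4 / 3 * (3 / 4) powr q" by (simp add: powr_diff)
      also have "real n powr (q - 1) * real n = N" using n by (simp add: powr_diff N_def)
      also have "x i powr (q - 1) = a i powr (1 - p)"
        using q by (simp add: x_def powr_powr algebra_simps)
      also have "a i powr (1 - p) * x k = E" by (simp add: E_def x_def)
      finally show ?thesis .
    qed
    finally have T1: "cmod ((w i + R) powr of_real q - z i) \<le> q * (4 / 3 * (3 / 4) powr q) * N * E" .
    \<comment> \<open>The factor \<open>2\<close> from \<open>2 powr (1 - q)\<close> is absorbed into \<open>q \<ge> 2\<close>.\<close>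
    have nN: "real n \<le> N * (q * (3 / 4) powr q)"
    proof -
      have "real n = N * real n powr (1 - q)" using n by (simp add: N_def flip: powr_add)
      also have "real n powr (1 - q) \<le> 2 powr (1 - q)" using n q by (intro powr_mono2') auto
      also have "2 powr (1 - q) = 2 * (1 / 2) powr q" by (simp add: powr_diff powr_divide)
      also have "\<dots> \<le> q * (3 / 4) powr q" using q by (intro mult_mono powr_mono2) auto
      finally show ?thesis using N0 by simp
    qed
    have akE: "a k \<le> E"
    proof -
      have "a k = a k powr (1 - p) * a k powr p" using a0 by (simp flip: powr_add)
      also have "\<dots> \<le> E" unfolding E_def using ak_le a0 p by (intro mult_right_mono powr_mono2) auto
      finally show ?thesis .
    qed
    have "cmod (\<Sum>j\<in>{1..n} - {i}. z j) \<le> real n * a k"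
      using rest_le a0(2)[of k] by (simp add: algebra_simps)
    also have "\<dots> \<le> N * (q * (3 / 4) powr q) * E"
      using nN akE a0 N0 q by (intro mult_mono) auto
    finally have T2: "cmod (\<Sum>j\<in>{1..n} - {i}. z j) \<le> N * (q * (3 / 4) powr q) * E" .
    have "cmod (of_real N * power_mean p n z - (\<Sum>j=1..n. z j))
        = cmod (((w i + R) powr of_real q - z i) - (\<Sum>j\<in>{1..n} - {i}. z j))"
      unfolding NA z_split by (simp add: algebra_simps)
    also have "\<dots> \<le> q * (4 / 3 * (3 / 4) powr q) * N * E + N * (q * (3 / 4) powr q) * E"
      by (rule order.trans[OF norm_triangle_ineq4 add_mono[OF T1 T2]])
    finally have "cmod (centred_quotient p n z)
        \<le> 2 / N * (q * (4 / 3 * (3 / 4) powr q) * N * E + N * (q * (3 / 4) powr q) * E)"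
      using N0 by (intro order.trans[OF num] mult_left_mono) auto
    \<comment> \<open>The constant is \<open>2 * (4 / 3 + 1)\<close>.\<close>
    also have "\<dots> = 14 / 3 * (q * (3 / 4) powr q * E)" using N0 by (simp add: field_simps)
    also have "\<dots> \<le> 5 * (q * (3 / 4) powr q * E)" using q D0 by (intro mult_right_mono) auto
    finally show ?thesis using D0 by (simp add: mult_ac)
  qed
  then show ?thesis by (simp add: D_def E_def a_def q_def)
qed

text \<open>Summing over all ordered pairs of distinct indices removes the dependence on which samples are the
two largest. For independent samples each summand is then a product of independent factors.\<close>

lemma centred_quotient_bound:
  assumes n: "n \<ge> 2" and p: "0 < p" "p \<le> 1 / 2"
    and z: "\<And>j. j \<in> {1..n} \<Longrightarrow> Im (z j) \<ge> 0"
  shows "cmod (centred_quotient p n z)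
     \<le> (\<Sum>i=1..n. \<Sum>k\<in>{1..n} - {i}. 4 * (cmod (z i) powr (3 / 4) * cmod (z k) powr (1 / 4)))
     + 5 / p * (3 / 4) powr (1 / p) * (\<Sum>i=1..n. \<Sum>k\<in>{1..n} - {i}. cmod (z i) powr (1 - p) * cmod (z k) powr p)"
proof -
  have fin: "finite {1..n}" "{1..n} \<noteq> {}" using n by auto
  have maximizer: "\<exists>i\<in>A. \<forall>j\<in>A. cmod (z j) \<le> cmod (z i)" if "finite A" "A \<noteq> {}" for A
  proof -
    have "Max ((\<lambda>j. cmod (z j)) ` A) \<in> (\<lambda>j. cmod (z j)) ` A" using that by (intro Max_in) auto
    then obtain i where "i \<in> A" "Max ((\<lambda>j. cmod (z j)) ` A) = cmod (z i)" by auto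
    then show ?thesis using that by (metis Max_ge finite_imageI imageI)
  qed
  obtain i where i: "i \<in> {1..n}" "\<And>j. j \<in> {1..n} \<Longrightarrow> cmod (z j) \<le> cmod (z i)"
    using maximizer[OF fin] by blast
  have "card ({1..n} - {i}) > 0" using n i by (simp add: card_Diff_singleton)
  then have fin': "finite ({1..n} - {i})" "{1..n} - {i} \<noteq> {}" unfolding card_gt_0_iff by auto
  obtain k where k: "k \<in> {1..n} - {i}" "\<And>j. j \<in> {1..n} - {i} \<Longrightarrow> cmod (z j) \<le> cmod (z k)"
    using maximizer[OF fin'] by blast
  have pick: "f i k \<le> (\<Sum>i'=1..n. \<Sum>k'\<in>{1..n} - {i'}. f i' k')"
    if "\<And>i k. f i k \<ge> 0" for f :: "nat \<Rightarrow> nat \<Rightarrow> real"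
  proof -
    have inner: "(\<Sum>k'\<in>{1..n} - {j}. f j k') \<ge> 0" for j using that by (simp add: sum_nonneg)
    have "f i k \<le> (\<Sum>k'\<in>{1..n} - {i}. f i k')"
      by (rule member_le_sum[OF k(1)]) (simp_all add: that)
    also have "\<dots> \<le> (\<Sum>i'=1..n. \<Sum>k'\<in>{1..n} - {i'}. f i' k')"
      by (rule member_le_sum[OF i(1)]) (simp_all only: inner finite_atLeastAtMost)
    finally show ?thesis .
  qed
  have "cmod (centred_quotient p n z)
     \<le> 4 * (cmod (z i) powr (3 / 4) * cmod (z k) powr (1 / 4))
       + 5 / p * (3 / 4) powr (1 / p) * (cmod (z i) powr (1 - p) * cmod (z k) powr p)"
    using i k z by (intro centred_quotient_bound_two_largest[OF n p]) auto
  also have "\<dots> \<le> (\<Sum>i=1..n. \<Sum>k\<in>{1..n} - {i}. 4 * (cmod (z i) powr (3 / 4) * cmod (z k) powr (1 / 4)))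
     + 5 / p * (3 / 4) powr (1 / p) * (\<Sum>i=1..n. \<Sum>k\<in>{1..n} - {i}. cmod (z i) powr (1 - p) * cmod (z k) powr p)"
    using p
    by (intro add_mono mult_left_mono
          pick[of "\<lambda>i k. 4 * (cmod (z i) powr (3 / 4) * cmod (z k) powr (1 / 4))"]
          pick[of "\<lambda>i k. cmod (z i) powr (1 - p) * cmod (z k) powr p"]) auto
  finally show ?thesis .
qed

section \<open>Moments and convergence in mean\<close>

lemma (in prob_space) indep_vars_expectation_product:
  fixes f g :: "real \<Rightarrow> real"
  assumes indep: "indep_vars (\<lambda>_. borel) X I" and ik: "i \<in> I" "k \<in> I" "i \<noteq> k"
    and [measurable]: "f \<in> borel_measurable borel" "g \<in> borel_measurable borel"
    and int: "integrable M (\<lambda>\<omega>. f (X i \<omega>))" "integrable M (\<lambda>\<omega>. g (X k \<omega>))"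
  shows "integrable M (\<lambda>\<omega>. f (X i \<omega>) * g (X k \<omega>))"
    and "expectation (\<lambda>\<omega>. f (X i \<omega>) * g (X k \<omega>))
           = expectation (\<lambda>\<omega>. f (X i \<omega>)) * expectation (\<lambda>\<omega>. g (X k \<omega>))"
proof -
  define h where "h m = (if m = i then f else g)" for m
  have "indep_vars (\<lambda>_. borel) X {i, k}"
    using ik by (intro indep_vars_subset[OF indep]) simp
  then have "indep_vars (\<lambda>_. borel) (\<lambda>m \<omega>. h m (X m \<omega>)) {i, k}"
    by (rule indep_vars_compose2) (simp add: h_def)
  moreover have "integrable M (\<lambda>\<omega>. h m (X m \<omega>))" if "m \<in> {i, k}" for m
    using that int by (auto simp: h_def)
  ultimately have fam: "finite {i, k}" "indep_vars (\<lambda>_. borel) (\<lambda>m \<omega>. h m (X m \<omega>)) {i, k}"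
    "\<And>m. m \<in> {i, k} \<Longrightarrow> integrable M (\<lambda>\<omega>. h m (X m \<omega>))"
    by simp_all
  show "integrable M (\<lambda>\<omega>. f (X i \<omega>) * g (X k \<omega>))"
    using indep_vars_integrable[OF fam] ik by (simp add: h_def)
  show "expectation (\<lambda>\<omega>. f (X i \<omega>) * g (X k \<omega>))
           = expectation (\<lambda>\<omega>. f (X i \<omega>)) * expectation (\<lambda>\<omega>. g (X k \<omega>))"
    using indep_vars_lebesgue_integral[OF fam] ik by (simp add: h_def)
qed

text \<open>Smaller exponents are controlled by larger ones through \<open>h powr r \<le> 1 + h powr s\<close>.\<close>

lemma (in finite_measure) integrable_powr_le:
  fixes h :: "'a \<Rightarrow> real"
  assumes [measurable]: "h \<in> borel_measurable M" and int: "integrable M (\<lambda>\<omega>. h \<omega> powr s)"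
    and r: "0 \<le> r" "r \<le> s" and h: "\<And>\<omega>. h \<omega> \<ge> 0"
  shows "integrable M (\<lambda>\<omega>. h \<omega> powr r)"
    and "(\<integral>\<omega>. h \<omega> powr r \<partial>M) \<le> measure M (space M) + (\<integral>\<omega>. h \<omega> powr s \<partial>M)"
proof -
  have le: "h \<omega> powr r \<le> 1 + h \<omega> powr s" for \<omega>
  proof (cases "h \<omega> \<le> 1")
    case True
    then show ?thesis using powr_le1[of r "h \<omega>"] r h[of \<omega>] by (simp add: add_increasing2)
  next
    case False
    then have "h \<omega> powr r \<le> h \<omega> powr s" using r by (intro powr_mono) auto
    then show ?thesis by linarith
  qed
  have int': "integrable M (\<lambda>\<omega>. 1 + h \<omega> powr s)" using int by simp
  show int_r: "integrable M (\<lambda>\<omega>. h \<omega> powr r)"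
    by (rule Bochner_Integration.integrable_bound[OF int']) (auto intro!: AE_I2 order.trans[OF le])
  have "(\<integral>\<omega>. h \<omega> powr r \<partial>M) \<le> (\<integral>\<omega>. 1 + h \<omega> powr s \<partial>M)"
    by (intro integral_mono int_r int' le)
  also have "\<dots> = measure M (space M) + (\<integral>\<omega>. h \<omega> powr s \<partial>M)" using int by simp
  finally show "(\<integral>\<omega>. h \<omega> powr r \<partial>M) \<le> measure M (space M) + (\<integral>\<omega>. h \<omega> powr s \<partial>M)" .
qed

lemma tendsto_powr_interpolation:
  fixes a b :: real
  assumes "a \<ge> 0"
  shows "((\<lambda>p. a powr (1 - p) * b powr p) \<longlongrightarrow> (if b = 0 then 0 else a)) (at_right 0)"
proof (cases "a = 0 \<or> b = 0")
  case False
  have "((\<lambda>p. a powr (1 - p) * b powr p) \<longlongrightarrow> a powr (1 - 0) * b powr 0) (at_right 0)"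
    using False by (intro tendsto_intros) auto
  then show ?thesis using False assms by simp
qed auto

text \<open>A dominated convergence theorem in which the dominating function may depend on \<open>p\<close>, as long as its
variable part \<open>U p\<close> vanishes both pointwise and in mean. In the limit the bound says that
\<open>cmod (Z \<omega>) \<le> D \<omega>\<close>. Hence the excess \<open>max 0 (cmod (Y p \<omega> - Z \<omega>) - U p \<omega>)\<close> is at most \<open>2 * D \<omega>\<close>, and
the usual theorem applies to it.\<close>

lemma L1_convergence_dominated_up_to_vanishing:
  fixes Y :: "real \<Rightarrow> 'a \<Rightarrow> complex"
  assumes d: "d > 0"
    and Y [measurable]: "\<And>p. 0 < p \<Longrightarrow> p < d \<Longrightarrow> Y p \<in> borel_measurable M"
    and Z [measurable]: "Z \<in> borel_measurable M"
    and lim: "AE \<omega> in M. ((\<lambda>p. Y p \<omega>) \<longlongrightarrow> Z \<omega>) (at_right 0)"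
    and D: "integrable M D" 
    and U: "\<And>p. 0 < p \<Longrightarrow> p < d \<Longrightarrow> integrable M (U p)"
    and U_lim: "\<And>\<omega>. \<omega> \<in> space M \<Longrightarrow> ((\<lambda>p. U p \<omega>) \<longlongrightarrow> 0) (at_right 0)"
    and U_int: "((\<lambda>p. \<integral>\<omega>. U p \<omega> \<partial>M) \<longlongrightarrow> 0) (at_right 0)"
    and bound: "\<And>p \<omega>. 0 < p \<Longrightarrow> p < d \<Longrightarrow> \<omega> \<in> space M \<Longrightarrow> cmod (Y p \<omega>) \<le> D \<omega> + U p \<omega>"
  shows "tendsto_L1 M Y Z (at_right 0)"
proof -
  have ev: "\<forall>\<^sub>F p in at_right (0::real). 0 < p \<and> p < d"
    using eventually_at_right_real[OF d] by (auto elim: eventually_mono)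
  have Z_le: "AE \<omega> in M. cmod (Z \<omega>) \<le> D \<omega>"
    using lim AE_space
  proof eventually_elim
    case (elim \<omega>)
    have "((\<lambda>p. D \<omega> + U p \<omega>) \<longlongrightarrow> D \<omega> + 0) (at_right 0)"
      using elim by (intro tendsto_intros U_lim)
    moreover have "\<forall>\<^sub>F p in at_right 0. cmod (Y p \<omega>) \<le> D \<omega> + U p \<omega>"
      using ev by eventually_elim (use bound elim in auto)
    ultimately show ?case
      using tendsto_le[OF _ _ tendsto_norm[OF elim(1)]] by simp
  qed
  have int_Z: "integrable M Z"
    using Z_le by (intro Bochner_Integration.integrable_bound[OF D]) auto
  have int_Y: "integrable M (Y p)" if "0 < p" "p < d" for p
    using that bound
    by (intro Bochner_Integration.integrable_bound[OF Bochner_Integration.integrable_add[OF D U[OF that]]])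
       (auto intro!: AE_I2 order.trans[OF _ abs_ge_self])
  define V where "V p \<omega> = max 0 (cmod (Y p \<omega> - Z \<omega>) - U p \<omega>)" for p \<omega>
  have int_V: "integrable M (V p)" if "0 < p" "p < d" for p
    unfolding V_def using that
    by (intro integrable_max Bochner_Integration.integrable_diff integrable_norm int_Y int_Z U) auto
  have "((\<lambda>p. \<integral>\<omega>. V p \<omega> \<partial>M) \<longlongrightarrow> 0) (at_right 0)"
  proof (rule tendsto_at_right_sequentially[OF d])
    fix S :: "nat \<Rightarrow> real"
    assume S: "\<And>m. 0 < S m" "\<And>m. S m < d" "S \<longlonglongrightarrow> 0"
    then have S_lim: "filterlim S (at_right 0) sequentially"
      by (auto intro!: tendsto_imp_filterlim_at_right always_eventually)
    have "(\<lambda>m. \<integral>\<omega>. V (S m) \<omega> \<partial>M) \<longlonglongrightarrow> (\<integral>\<omega>. 0 \<partial>M)"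
    proof (rule integral_dominated_convergence[where w = "\<lambda>\<omega>. 2 * D \<omega>"])
      show "integrable M (\<lambda>\<omega>. 2 * D \<omega>)" using D by simp
      show "V (S m) \<in> borel_measurable M" for m
        using int_V[of "S m"] S by auto
      show "AE \<omega> in M. norm (V (S m) \<omega>) \<le> 2 * D \<omega>" for m
        using Z_le AE_space
      proof eventually_elim
        case (elim \<omega>)
        have "cmod (Y (S m) \<omega> - Z \<omega>) \<le> cmod (Y (S m) \<omega>) + cmod (Z \<omega>)"
          by (rule norm_triangle_ineq4)
        also have "\<dots> \<le> (D \<omega> + U (S m) \<omega>) + D \<omega>"
          using elim bound[OF S(1,2)] by (intro add_mono) auto
        finally show ?case
          using order.trans[OF norm_ge_zero elim(1)] unfolding V_def by simp
      qed
      show "AE \<omega> in M. (\<lambda>m. V (S m) \<omega>) \<longlonglongrightarrow> 0"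
        using lim AE_space
      proof eventually_elim
        case (elim \<omega>)
        have "((\<lambda>p. V p \<omega>) \<longlongrightarrow> max 0 (cmod (Z \<omega> - Z \<omega>) - 0)) (at_right 0)"
          unfolding V_def using elim by (intro tendsto_intros U_lim)
        then show ?case using filterlim_compose[OF _ S_lim] by simp
      qed
    qed simp
    then show "(\<lambda>m. \<integral>\<omega>. V (S m) \<omega> \<partial>M) \<longlonglongrightarrow> 0" by simp
  qed
  from tendsto_add[OF this U_int]
  have upper: "((\<lambda>p. (\<integral>\<omega>. V p \<omega> \<partial>M) + (\<integral>\<omega>. U p \<omega> \<partial>M)) \<longlongrightarrow> 0) (at_right 0)" by simp
  have "((\<lambda>p. \<integral>\<omega>. norm (Y p \<omega> - Z \<omega>) \<partial>M) \<longlongrightarrow> 0) (at_right 0)"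
  proof (rule tendsto_sandwich[OF _ _ tendsto_const upper])
    show "\<forall>\<^sub>F p in at_right 0. (\<integral>\<omega>. norm (Y p \<omega> - Z \<omega>) \<partial>M)
        \<le> (\<integral>\<omega>. V p \<omega> \<partial>M) + (\<integral>\<omega>. U p \<omega> \<partial>M)"
      using ev
    proof eventually_elim
      case (elim p)
      have "(\<integral>\<omega>. norm (Y p \<omega> - Z \<omega>) \<partial>M) \<le> (\<integral>\<omega>. V p \<omega> + U p \<omega> \<partial>M)"
        using elim int_Y int_Z int_V U
        by (intro integral_mono integrable_norm Bochner_Integration.integrable_diff
              Bochner_Integration.integrable_add) (auto simp: V_def)
      also have "\<dots> = (\<integral>\<omega>. V p \<omega> \<partial>M) + (\<integral>\<omega>. U p \<omega> \<partial>M)"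
        using elim int_V U by simp
      finally show ?case .
    qed
  qed auto
  moreover have "\<forall>\<^sub>F p in at_right 0. integrable M (Y p)"
    using ev by eventually_elim (use int_Y in auto)
  ultimately show ?thesis using int_Z unfolding tendsto_L1_def by simp
qed

section \<open>Convergence of the quotient\<close>

theorem theorem5p3:
  fixes M :: "'a measure" and X :: "nat \<Rightarrow> 'a \<Rightarrow> real"
    and n :: nat and \<alpha> :: complex and l :: real
  assumes "prob_space M"
    and "prob_space.indep_vars M (\<lambda>_. borel) X {1..}"
    and "\<And>j. j \<ge> 1 \<Longrightarrow> distr M borel (X j) = distr M borel (X 1)"
    and "continuous_on UNIV (cdf (distr M borel (X 1)))"
    and "n \<ge> 2"
    and "Im \<alpha> \<ge> 0"
    and "l > 0"
    and "\<forall>\<^sub>F \<eta> in at_right 0.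
           integrable M (\<lambda>\<omega>. cmod (complex_of_real (X 1 \<omega>) + \<alpha>) powr (1 - \<eta>))"
    and "(\<lambda>\<eta>. \<integral>\<omega>. cmod (complex_of_real (X 1 \<omega>) + \<alpha>) powr (1 - \<eta>) \<partial>M)
           \<in> O[at_right 0](\<lambda>\<eta>. \<eta> powr (- l))"
  shows "(AE \<omega> in M. ((\<lambda>p. mean_quotient \<alpha> p n (\<lambda>j. X j \<omega>))
             \<longlongrightarrow> shifted_geometric_mean \<alpha> n (\<lambda>j. X j \<omega>)) (at_right 0))
       \<and> tendsto_L1 M (\<lambda>p \<omega>. mean_quotient \<alpha> p n (\<lambda>j. X j \<omega>))
           (\<lambda>\<omega>. shifted_geometric_mean \<alpha> n (\<lambda>j. X j \<omega>)) (at_right 0)"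
proof -
  interpret prob_space M by fact
  note indep = assms(2) and ident = assms(3) and cont = assms(4) and n = assms(5)
    and \<alpha> = assms(6) and l = assms(7) and ev_int = assms(8) and growth = assms(9)
  have X_meas [measurable]: "X j \<in> borel_measurable M" if "j \<ge> 1" for j
    using indep that by (auto simp: indep_vars_def)
  define Z where "Z j \<omega> = complex_of_real (X j \<omega>) + \<alpha>" for j \<omega>
  define \<mu> where "\<mu> r = (\<integral>\<omega>. cmod (Z 1 \<omega>) powr r \<partial>M)" for r
  have Z_meas [measurable]: "Z j \<in> borel_measurable M" if "j \<ge> 1" for j
    unfolding Z_def[abs_def] using X_meas[OF that] by measurable
  have Z_upper: "Im (Z j \<omega>) \<ge> 0" for j \<omega> using \<alpha> by (simp add: Z_def)

  \<comment> \<open>The order \<open>1 - \<eta>\<close> is available for some \<open>\<eta> < 1 - r\<close>, and it controls the order \<open>r\<close>.\<close>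
  have int_1: "integrable M (\<lambda>\<omega>. cmod (Z 1 \<omega>) powr r)" if r: "0 \<le> r" "r < 1" for r
  proof -
    have "\<forall>\<^sub>F \<eta> in at_right 0. 0 < \<eta> \<and> \<eta> < 1 - r"
      using eventually_at_right_real[of 0 "1 - r"] r by (auto elim: eventually_mono)
    then have "\<forall>\<^sub>F \<eta> in at_right (0::real). \<eta> < 1 - r \<and> integrable M (\<lambda>\<omega>. cmod (Z 1 \<omega>) powr (1 - \<eta>))"
      using ev_int unfolding Z_def by eventually_elim auto
    then obtain \<eta> where "\<eta> < 1 - r" "integrable M (\<lambda>\<omega>. cmod (Z 1 \<omega>) powr (1 - \<eta>))"
      using eventually_happens'[OF trivial_limit_at_right_real] by blast
    then show ?thesis
      using r integrable_powr_le(1)[of "\<lambda>\<omega>. cmod (Z 1 \<omega>)" "1 - \<eta>" r] by simp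
  qed
  have moment: "integrable M (\<lambda>\<omega>. cmod (Z j \<omega>) powr r)" "(\<integral>\<omega>. cmod (Z j \<omega>) powr r \<partial>M) = \<mu> r"
    if j: "j \<ge> 1" and r: "0 \<le> r" "r < 1" for j r
  proof -
    let ?g = "\<lambda>x. cmod (complex_of_real x + \<alpha>) powr r"
    have "integrable (distr M borel (X 1)) ?g"
      using int_1[OF r] by (subst integrable_distr_eq) (auto simp: Z_def)
    then show "integrable M (\<lambda>\<omega>. cmod (Z j \<omega>) powr r)"
      unfolding ident[OF j, symmetric] using j by (subst (asm) integrable_distr_eq) (auto simp: Z_def)
    have "(\<integral>\<omega>. ?g (X j \<omega>) \<partial>M) = integral\<^sup>L (distr M borel (X j)) ?g"
      using j by (intro integral_distr[symmetric]) auto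
    also have "\<dots> = (\<integral>\<omega>. ?g (X 1 \<omega>) \<partial>M)"
      unfolding ident[OF j] by (intro integral_distr) auto
    finally show "(\<integral>\<omega>. cmod (Z j \<omega>) powr r \<partial>M) = \<mu> r" by (simp add: \<mu>_def Z_def)
  qed
  have pair: "integrable M (\<lambda>\<omega>. cmod (Z i \<omega>) powr r * cmod (Z k \<omega>) powr s)"
      "(\<integral>\<omega>. cmod (Z i \<omega>) powr r * cmod (Z k \<omega>) powr s \<partial>M) = \<mu> r * \<mu> s"
    if "i \<in> {1..n}" "k \<in> {1..n} - {i}" "0 \<le> r" "r < 1" "0 \<le> s" "s < 1" for i k r s
    using that moment[of i r] moment[of k s]
      indep_vars_expectation_product[OF indep, of i k
        "\<lambda>x. cmod (complex_of_real x + \<alpha>) powr r" "\<lambda>x. cmod (complex_of_real x + \<alpha>) powr s"]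
    by (auto simp: Z_def)

  have lim: "AE \<omega> in M. ((\<lambda>p. mean_quotient \<alpha> p n (\<lambda>j. X j \<omega>))
             \<longlongrightarrow> shifted_geometric_mean \<alpha> n (\<lambda>j. X j \<omega>)) (at_right 0)"
  proof -
    \<comment> \<open>A continuous distribution has no atom at \<open>- Re \<alpha>\<close>, the only value of \<open>X j\<close> that makes \<open>Z j\<close> vanish.\<close>
    have "AE \<omega> in M. \<forall>j\<in>{1..n}. Z j \<omega> \<noteq> 0"
    proof (rule AE_finite_allI)
      fix j assume "j \<in> {1..n}"
      then have j: "j \<ge> 1" by simp
      interpret law: real_distribution "distr M borel (X j)"
        using j by (intro real_distribution_distr) auto
      have "isCont (cdf (distr M borel (X j))) (- Re \<alpha>)"
        unfolding ident[OF j] using cont by (simp add: continuous_on_eq_continuous_at)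
      then have "law.prob {- Re \<alpha>} = 0" by (simp add: law.isCont_cdf)
      then have "AE x in distr M borel (X j). x \<noteq> - Re \<alpha>"
        using AE_not_in[of "{- Re \<alpha>}" "distr M borel (X j)"]
        by (auto simp: null_sets_def law.emeasure_eq_measure)
      then have "AE \<omega> in M. X j \<omega> \<noteq> - Re \<alpha>"
        using j by (subst (asm) AE_distr_iff) auto
      then show "AE \<omega> in M. Z j \<omega> \<noteq> 0"
        by eventually_elim (auto simp: Z_def complex_eq_iff)
    qed simp
    then show ?thesis
    proof eventually_elim
      case (elim \<omega>)
      have "((\<lambda>p. centred_quotient p n (\<lambda>j. Z j \<omega>) - \<alpha>)
          \<longlongrightarrow> (\<Prod>j=1..n. Z j \<omega> powr (1 / of_nat n)) - \<alpha>) (at_right 0)"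
        using elim by (intro tendsto_intros centred_quotient_tendsto_geometric_mean n) auto
      moreover have "\<forall>\<^sub>F p in at_right 0.
          centred_quotient p n (\<lambda>j. Z j \<omega>) - \<alpha> = mean_quotient \<alpha> p n (\<lambda>j. X j \<omega>)"
        using eventually_at_right_real[OF zero_less_one]
        by eventually_elim (use n in \<open>auto simp: mean_quotient_eq_centred_quotient Z_def\<close>)
      ultimately show ?case
        unfolding shifted_geometric_mean_def Z_def[symmetric] by (rule Lim_transform_eventually)
    qed
  qed

  define D where "D \<omega> = cmod \<alpha> + (\<Sum>i=1..n. \<Sum>k\<in>{1..n} - {i}.
      4 * (cmod (Z i \<omega>) powr (3 / 4) * cmod (Z k \<omega>) powr (1 / 4)))" for \<omega>
  define U where "U p \<omega> = 5 / p * (3 / 4) powr (1 / p) * (\<Sum>i=1..n. \<Sum>k\<in>{1..n} - {i}.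
      cmod (Z i \<omega>) powr (1 - p) * cmod (Z k \<omega>) powr p)" for p \<omega>
  have "tendsto_L1 M (\<lambda>p \<omega>. mean_quotient \<alpha> p n (\<lambda>j. X j \<omega>))
           (\<lambda>\<omega>. shifted_geometric_mean \<alpha> n (\<lambda>j. X j \<omega>)) (at_right 0)"
  proof (rule L1_convergence_dominated_up_to_vanishing[where d = "1 / 2"])
    show "(\<lambda>\<omega>. mean_quotient \<alpha> p n (\<lambda>j. X j \<omega>)) \<in> borel_measurable M" for p
      unfolding mean_quotient_def shifted_power_mean_def arithmetic_mean_def
      by (intro borel_measurable_divide borel_measurable_diff borel_measurable_times borel_measurable_const
        powr_complex_measurable borel_measurable_sum borel_measurable_add
        measurable_compose[OF _ borel_measurable_of_real] X_meas) auto
    show "(\<lambda>\<omega>. shifted_geometric_mean \<alpha> n (\<lambda>j. X j \<omega>)) \<in> borel_measurable M"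
      unfolding shifted_geometric_mean_def
      by (intro borel_measurable_diff borel_measurable_prod borel_measurable_const
        powr_complex_measurable borel_measurable_add
        measurable_compose[OF _ borel_measurable_of_real] X_meas) auto
    show "integrable M D"
      unfolding D_def using pair
      by (intro Bochner_Integration.integrable_add Bochner_Integration.integrable_sum integrable_mult_right) auto
    show "integrable M (U p)" if "0 < p" "p < 1 / 2" for p
      unfolding U_def using pair that
      by (intro Bochner_Integration.integrable_sum integrable_mult_right) auto
    have weight: "((\<lambda>p::real. 5 / p * (3 / 4) powr (1 / p)) \<longlongrightarrow> 0) (at_right 0)"
      by real_asymp
    show "((\<lambda>p. U p \<omega>) \<longlongrightarrow> 0) (at_right 0)" for \<omega>
    proof -
      have "((\<lambda>p. U p \<omega>) \<longlongrightarrow> 0 * (\<Sum>i=1..n. \<Sum>k\<in>{1..n} - {i}.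
          if cmod (Z k \<omega>) = 0 then 0 else cmod (Z i \<omega>))) (at_right 0)"
        unfolding U_def
        by (intro tendsto_mult weight tendsto_sum tendsto_powr_interpolation norm_ge_zero)
      then show ?thesis by simp
    qed
    show "cmod (mean_quotient \<alpha> p n (\<lambda>j. X j \<omega>)) \<le> D \<omega> + U p \<omega>" if "0 < p" "p < 1 / 2" for p \<omega>
    proof -
      have "cmod (mean_quotient \<alpha> p n (\<lambda>j. X j \<omega>)) \<le> cmod (centred_quotient p n (\<lambda>j. Z j \<omega>)) + cmod \<alpha>"
        using that n by (simp add: mean_quotient_eq_centred_quotient Z_def norm_triangle_ineq4)
      then show ?thesis
        using centred_quotient_bound[OF n that(1), of "\<lambda>j. Z j \<omega>"] that Z_upper by (simp add: D_def U_def)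
    qed
    define K where "K = (\<Sum>i=1..n. \<Sum>k\<in>{1..n} - {i}. 1 :: real)"
    have \<mu>_nonneg: "\<mu> r \<ge> 0" for r by (simp add: \<mu>_def)
    have K: "K \<ge> 0" unfolding K_def by (intro sum_nonneg) simp
    have U_int: "(\<integral>\<omega>. U p \<omega> \<partial>M) = 5 / p * (3 / 4) powr (1 / p) * (K * (\<mu> (1 - p) * \<mu> p))"
      if "0 < p" "p < 1 / 2" for p
    proof -
      let ?f = "\<lambda>i k \<omega>. cmod (Z i \<omega>) powr (1 - p) * cmod (Z k \<omega>) powr p"
      have f: "integrable M (?f i k)" "integral\<^sup>L M (?f i k) = \<mu> (1 - p) * \<mu> p"
        if "i \<in> {1..n}" "k \<in> {1..n} - {i}" for i k
        using pair[OF that, of "1 - p" p] \<open>0 < p\<close> \<open>p < 1 / 2\<close> by auto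
      have "(\<integral>\<omega>. (\<Sum>i=1..n. \<Sum>k\<in>{1..n} - {i}. ?f i k \<omega>) \<partial>M)
          = (\<Sum>i=1..n. \<integral>\<omega>. (\<Sum>k\<in>{1..n} - {i}. ?f i k \<omega>) \<partial>M)"
        by (intro Bochner_Integration.integral_sum Bochner_Integration.integrable_sum f)
      also have "\<dots> = (\<Sum>i=1..n. \<Sum>k\<in>{1..n} - {i}. integral\<^sup>L M (?f i k))"
        by (intro sum.cong refl Bochner_Integration.integral_sum f)
      also have "\<dots> = (\<Sum>i=1..n. \<Sum>k\<in>{1..n} - {i}. \<mu> (1 - p) * \<mu> p)"
        by (intro sum.cong refl f)
      also have "\<dots> = K * (\<mu> (1 - p) * \<mu> p)" by (simp add: K_def sum_distrib_right)
      finally show ?thesis by (simp add: U_def)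
    qed
    obtain c where c: "c > 0" "\<forall>\<^sub>F p in at_right 0. norm (\<mu> (1 - p)) \<le> c * norm (p powr (- l))"
      using growth unfolding \<mu>_def Z_def by (elim landau_o.bigE)
    show "((\<lambda>p. \<integral>\<omega>. U p \<omega> \<partial>M) \<longlongrightarrow> 0) (at_right 0)"
    proof (rule tendsto_sandwich[OF _ _ tendsto_const])
      \<comment> \<open>The exponential decay of \<open>(3 / 4) powr (1 / p)\<close> beats the polynomial growth of \<open>\<mu> (1 - p)\<close>.\<close>
      have "((\<lambda>p::real. 5 / p * (3 / 4) powr (1 / p) * p powr (- l)) \<longlongrightarrow> 0) (at_right 0)"
        using l by real_asymp
      from tendsto_mult_right[OF this, of "K * c * (1 + \<mu> (1 / 2))"]
      show "((\<lambda>p. 5 / p * (3 / 4) powr (1 / p) * p powr (- l) * (K * c * (1 + \<mu> (1 / 2)))) \<longlongrightarrow> 0) (at_right 0)"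
        by simp
      have half: "\<forall>\<^sub>F p in at_right (0::real). 0 < p \<and> p < 1 / 2"
        using eventually_at_right_real[of 0 "1 / 2 :: real"] by (auto elim: eventually_mono)
      show "\<forall>\<^sub>F p in at_right 0. 0 \<le> (\<integral>\<omega>. U p \<omega> \<partial>M)"
        using half by eventually_elim (use U_int K \<mu>_nonneg in auto)
      show "\<forall>\<^sub>F p in at_right 0. (\<integral>\<omega>. U p \<omega> \<partial>M)
          \<le> 5 / p * (3 / 4) powr (1 / p) * p powr (- l) * (K * c * (1 + \<mu> (1 / 2)))"
        using half c(2)
      proof eventually_elim
        case (elim p)
        have "\<mu> p \<le> 1 + \<mu> (1 / 2)"
          using integrable_powr_le(2)[of "\<lambda>\<omega>. cmod (Z 1 \<omega>)" "1 / 2" p] int_1[of "1 / 2"] elim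
          by (simp add: \<mu>_def prob_space)
        then have "\<mu> (1 - p) * \<mu> p \<le> (c * p powr (- l)) * (1 + \<mu> (1 / 2))"
          using elim c(1) \<mu>_nonneg by (intro mult_mono) auto
        then have "5 / p * (3 / 4) powr (1 / p) * (K * (\<mu> (1 - p) * \<mu> p))
            \<le> 5 / p * (3 / 4) powr (1 / p) * (K * ((c * p powr (- l)) * (1 + \<mu> (1 / 2))))"
          using elim K by (intro mult_left_mono) auto
        then show ?case using elim U_int by (simp add: mult_ac)
      qed
    qed
  qed (use lim in auto)
  with lim show ?thesis by blast
qed

end
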